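(* Let $\mathcal{C}$ be a category and $A\in\mathcal{C}$ an object such that: (i) every arrow $Y\to X$ in $\mathcal{C}$ is a strict epimorphism; (ii) for every $X\in\mathcal{C}$ there exists an arrow $A\to X$; (iii) the representable functor $F=[A,-]:\mathcal{C}\to\mathcal{E}ns$ preserves strict epimorphisms. Then every arrow $x:A\to X$ in $\mathcal{C}$ is the categorical quotient of $A$ by the action of the Galois group $Fix(x)=\{h\in Aut(A)\mid xh=x\}\subset Aut(A)$.
   Context: $\mathcal{E}ns$ is the category of sets and $[A,X]$ is the set of arrows $A\to X$. An arrow $f:X\to Y$ is a strict epimorphism if for every arrow $g:X\to Z$ such that, for all $C$ and all $s,t:C\to X$, $fs=ft$ implies $gs=gt$, there is a unique $h:Y\to Z$ with $g=hf$. (In $\mathcal{E}ns$ strict epimorphisms are the surjections.) For a subgroup $H\subset Aut(A)$, an arrow $x:A\to X$ is the categorical quotient of $A$ by the action of $H$ if $xh=x$ for all $h\in H$, and for every arrow $y:A\to Y$ in $\mathcal{C}$ with $yh=y$ for all $h\in H$ there is a unique $g:X\to Y$ with $gx=y$. *)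

theory Defs
  imports "HOL-Algebra.Group"
begin

record ('o, 'a) cat =
  Obj :: "'o set"
  Arr :: "'a set"
  Dom :: "'a \<Rightarrow> 'o"
  Cod :: "'a \<Rightarrow> 'o"
  Id :: "'o \<Rightarrow> 'a"
  Comp :: "'a \<Rightarrow> 'a \<Rightarrow> 'a"  (infixl "\<cdot>\<index>" 70)

definition Hom :: "('o, 'a, 'z) cat_scheme \<Rightarrow> 'o \<Rightarrow> 'o \<Rightarrow> 'a set" where
  "Hom C X Y = {f \<in> Arr C. Dom C f = X \<and> Cod C f = Y}"

text \<open>Composition is in the order of functions: \<open>g \<cdot> f\<close> is meaningful when the codomain of \<open>f\<close>
  is the domain of \<open>g\<close>.\<close>

locale category =
  fixes C :: "('o, 'a, 'z) cat_scheme" (structure)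
  assumes Dom_closed: "f \<in> Arr C \<Longrightarrow> Dom C f \<in> Obj C"
    and Cod_closed: "f \<in> Arr C \<Longrightarrow> Cod C f \<in> Obj C"
    and Id_closed: "X \<in> Obj C \<Longrightarrow> Id C X \<in> Hom C X X"
    and Comp_closed: "\<lbrakk>f \<in> Hom C X Y; g \<in> Hom C Y Z\<rbrakk> \<Longrightarrow> g \<cdot> f \<in> Hom C X Z"
    and Comp_assoc: "\<lbrakk>f \<in> Hom C X Y; g \<in> Hom C Y Z; h \<in> Hom C Z W\<rbrakk>
      \<Longrightarrow> (h \<cdot> g) \<cdot> f = h \<cdot> (g \<cdot> f)"
    and Comp_Id_left: "f \<in> Hom C X Y \<Longrightarrow> Id C Y \<cdot> f = f"
    and Comp_Id_right: "f \<in> Hom C X Y \<Longrightarrow> f \<cdot> Id C X = f"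

definition strict_epi :: "('o, 'a, 'z) cat_scheme \<Rightarrow> 'a \<Rightarrow> bool" where
  "strict_epi C f \<longleftrightarrow> f \<in> Arr C \<and>
    (\<forall>Z\<in>Obj C. \<forall>g\<in>Hom C (Dom C f) Z.
      (\<forall>W\<in>Obj C. \<forall>s\<in>Hom C W (Dom C f). \<forall>t\<in>Hom C W (Dom C f).
        f \<cdot>\<^bsub>C\<^esub> s = f \<cdot>\<^bsub>C\<^esub> t \<longrightarrow> g \<cdot>\<^bsub>C\<^esub> s = g \<cdot>\<^bsub>C\<^esub> t) \<longrightarrow>
      (\<exists>!h. h \<in> Hom C (Cod C f) Z \<and> g = h \<cdot>\<^bsub>C\<^esub> f))"

text \<open>The category of sets with elements in the type \<open>'m\<close>; the type plays the role of the universe.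
  An arrow carries its domain and codomain, and its underlying function is extensional, so that
  equality of arrows is equality of maps between sets.\<close>

definition Ens :: "('m set, 'm set \<times> 'm set \<times> ('m \<Rightarrow> 'm)) cat" where
  "Ens = \<lparr>Obj = UNIV,
    Arr = {(X, Y, f). f \<in> X \<rightarrow>\<^sub>E Y},
    Dom = (\<lambda>(X, Y, f). X),
    Cod = (\<lambda>(X, Y, f). Y),
    Id = (\<lambda>X. (X, X, \<lambda>x\<in>X. x)),
    Comp = (\<lambda>(Y', Z, g) (X, Y, f). (X, Z, compose X g f))\<rparr>"

locale cat_functor = C: category C + D: category D
  for C :: "('o, 'a, 'y) cat_scheme" and D :: "('p, 'b, 'z) cat_scheme" +
  fixes Fo :: "'o \<Rightarrow> 'p" and Fa :: "'a \<Rightarrow> 'b"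
  assumes Fo_closed: "X \<in> Obj C \<Longrightarrow> Fo X \<in> Obj D"
    and Fa_closed: "f \<in> Hom C X Y \<Longrightarrow> Fa f \<in> Hom D (Fo X) (Fo Y)"
    and Fa_Id: "X \<in> Obj C \<Longrightarrow> Fa (Id C X) = Id D (Fo X)"
    and Fa_Comp: "\<lbrakk>f \<in> Hom C X Y; g \<in> Hom C Y Z\<rbrakk> \<Longrightarrow> Fa (g \<cdot>\<^bsub>C\<^esub> f) = Fa g \<cdot>\<^bsub>D\<^esub> Fa f"

definition preserves_strict_epis ::
    "('o, 'a, 'y) cat_scheme \<Rightarrow> ('p, 'b, 'z) cat_scheme \<Rightarrow> ('a \<Rightarrow> 'b) \<Rightarrow> bool" where
  "preserves_strict_epis C D Fa \<longleftrightarrow> (\<forall>f. strict_epi C f \<longrightarrow> strict_epi D (Fa f))"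

text \<open>The representable functor \<open>[A,-]\<close> is \<open>Hom C A\<close> on objects and \<open>hom_map C A\<close>, that is
  post-composition, on arrows. Since the elements of the sets \<open>[A,X]\<close> are arrows of \<open>C\<close>, its
  target is \<open>Ens\<close> over the type of arrows.\<close>

definition hom_map ::
    "('o, 'a, 'z) cat_scheme \<Rightarrow> 'o \<Rightarrow> 'a \<Rightarrow> 'a set \<times> 'a set \<times> ('a \<Rightarrow> 'a)" where
  "hom_map C A f =
    (Hom C A (Dom C f), Hom C A (Cod C f), \<lambda>u\<in>Hom C A (Dom C f). f \<cdot>\<^bsub>C\<^esub> u)"

definition Aut :: "('o, 'a, 'z) cat_scheme \<Rightarrow> 'o \<Rightarrow> 'a monoid" where
  "Aut C A =
    \<lparr>carrier = {h \<in> Hom C A A. \<exists>k\<in>Hom C A A. h \<cdot>\<^bsub>C\<^esub> k = Id C A \<and> k \<cdot>\<^bsub>C\<^esub> h = Id C A},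
     mult = (\<lambda>g h. g \<cdot>\<^bsub>C\<^esub> h),
     one = Id C A\<rparr>"

definition Fix :: "('o, 'a, 'z) cat_scheme \<Rightarrow> 'a \<Rightarrow> 'a set" where
  "Fix C x = {h \<in> carrier (Aut C (Dom C x)). x \<cdot>\<^bsub>C\<^esub> h = x}"

definition categorical_quotient ::
    "('o, 'a, 'z) cat_scheme \<Rightarrow> 'o \<Rightarrow> 'a set \<Rightarrow> 'o \<Rightarrow> 'a \<Rightarrow> bool" where
  "categorical_quotient C A H X x \<longleftrightarrow>
    subgroup H (Aut C A) \<and> x \<in> Hom C A X \<and> (\<forall>h\<in>H. x \<cdot>\<^bsub>C\<^esub> h = x) \<and>
    (\<forall>Y\<in>Obj C. \<forall>y\<in>Hom C A Y. (\<forall>h\<in>H. y \<cdot>\<^bsub>C\<^esub> h = y) \<longrightarrow>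
      (\<exists>!g. g \<in> Hom C X Y \<and> g \<cdot>\<^bsub>C\<^esub> x = y))"

lemma category_Ens: "category Ens"
  by unfold_locales
    (auto simp: Ens_def Hom_def compose_def PiE_def extensional_def Pi_def fun_eq_iff,
      metis+)

lemma Hom_Ens: "\<phi> \<in> Hom Ens X Y \<longleftrightarrow> (\<exists>f. \<phi> = (X, Y, f) \<and> f \<in> X \<rightarrow>\<^sub>E Y)"
  by (auto simp: Hom_def Ens_def)

lemma Comp_Ens: "(Y', Z, g) \<cdot>\<^bsub>Ens\<^esub> (X, Y, f) = (X, Z, compose X g f)"
  by (simp add: Ens_def)

lemma strict_epi_Ens_iff:
  fixes f :: "'m \<Rightarrow> 'm"
  shows "strict_epi Ens (X, Y, f) \<longleftrightarrow> f \<in> X \<rightarrow>\<^sub>E Y \<and> f ` X = Y"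
proof
  assume S: "strict_epi Ens (X, Y, f)"
  then have f: "f \<in> X \<rightarrow>\<^sub>E Y" by (auto simp: strict_epi_def Ens_def)
  have ex1: "\<exists>!\<eta>. \<eta> \<in> Hom Ens Y Z \<and> \<gamma> = \<eta> \<cdot>\<^bsub>Ens\<^esub> (X, Y, f)"
    if "\<gamma> \<in> Hom Ens X Z" "\<And>W \<sigma> \<tau>. \<lbrakk>\<sigma> \<in> Hom Ens W X; \<tau> \<in> Hom Ens W X;
      (X, Y, f) \<cdot>\<^bsub>Ens\<^esub> \<sigma> = (X, Y, f) \<cdot>\<^bsub>Ens\<^esub> \<tau>\<rbrakk> \<Longrightarrow> \<gamma> \<cdot>\<^bsub>Ens\<^esub> \<sigma> = \<gamma> \<cdot>\<^bsub>Ens\<^esub> \<tau>" for Z \<gamma>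
  proof -
    have d: "Dom Ens (X, Y, f) = X" "Cod Ens (X, Y, f) = Y" "Z \<in> Obj Ens"
      by (simp_all add: Ens_def)
    note * = S[unfolded strict_epi_def d(1,2), THEN conjunct2, THEN bspec, OF d(3),
      THEN bspec, OF that(1), THEN mp]
    show ?thesis by (rule *) (blast intro: that(2))
  qed
  have "\<exists>!\<eta>. \<eta> \<in> Hom Ens Y (f ` X) \<and> (X, f ` X, f) = \<eta> \<cdot>\<^bsub>Ens\<^esub> (X, Y, f)"
    by (rule ex1) (use f in \<open>auto simp: Hom_Ens Comp_Ens\<close>)
  then obtain \<eta> where e: "\<eta> \<in> Hom Ens Y (f ` X)" "(X, f ` X, f) = \<eta> \<cdot>\<^bsub>Ens\<^esub> (X, Y, f)"
    by blast
  then obtain h where eh: "\<eta> = (Y, f ` X, h)" and h: "h \<in> Y \<rightarrow>\<^sub>E f ` X"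
    unfolding Hom_Ens by blast
  have hf: "compose X h f = f" using e(2) by (simp add: eh Comp_Ens)
  have "\<exists>!\<eta>. \<eta> \<in> Hom Ens Y Y \<and> (X, Y, f) = \<eta> \<cdot>\<^bsub>Ens\<^esub> (X, Y, f)"
    by (rule ex1) (use f in \<open>auto simp: Hom_Ens\<close>)
  moreover have "f ` X \<subseteq> Y" using f by auto
  then have "(Y, Y, h) \<in> Hom Ens Y Y \<and> (X, Y, f) = (Y, Y, h) \<cdot>\<^bsub>Ens\<^esub> (X, Y, f)"
    using h hf by (auto simp: Hom_Ens Comp_Ens dest: PiE_mem)
  moreover have "compose X (\<lambda>y\<in>Y. y) f = f"
    using f by (auto simp: fun_eq_iff compose_def PiE_def extensional_def)
  then have "(Y, Y, \<lambda>y\<in>Y. y) \<in> Hom Ens Y Y \<and> (X, Y, f) = (Y, Y, \<lambda>y\<in>Y. y) \<cdot>\<^bsub>Ens\<^esub> (X, Y, f)"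
    by (auto simp: Hom_Ens Comp_Ens)
  ultimately have "(Y, Y, h) = (Y, Y, \<lambda>y\<in>Y. y)" by blast
  then have "h = (\<lambda>y\<in>Y. y)" by simp
  then have "Y \<subseteq> f ` X" using h by (auto simp: PiE_def Pi_def)
  with f show "f \<in> X \<rightarrow>\<^sub>E Y \<and> f ` X = Y" by auto
next
  assume A: "f \<in> X \<rightarrow>\<^sub>E Y \<and> f ` X = Y"
  have factor: "\<exists>!\<eta>. \<eta> \<in> Hom Ens Y Z \<and> (X, Z, g) = \<eta> \<cdot>\<^bsub>Ens\<^esub> (X, Y, f)"
    if g: "g \<in> X \<rightarrow>\<^sub>E Z" and K: "\<And>W \<sigma> \<tau>. \<lbrakk>\<sigma> \<in> Hom Ens W X; \<tau> \<in> Hom Ens W X;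
      (X, Y, f) \<cdot>\<^bsub>Ens\<^esub> \<sigma> = (X, Y, f) \<cdot>\<^bsub>Ens\<^esub> \<tau>\<rbrakk> \<Longrightarrow> (X, Z, g) \<cdot>\<^bsub>Ens\<^esub> \<sigma> = (X, Z, g) \<cdot>\<^bsub>Ens\<^esub> \<tau>" for Z g
  proof -
    have eq: "g a = g b" if ab: "a \<in> X" "b \<in> X" "f a = f b" for a b
    proof -
      have "(X, Z, g) \<cdot>\<^bsub>Ens\<^esub> ({a}, X, \<lambda>c\<in>{a}. a) = (X, Z, g) \<cdot>\<^bsub>Ens\<^esub> ({a}, X, \<lambda>c\<in>{a}. b)"
      proof (rule K)
        have "(\<lambda>c\<in>{a}. a) \<in> {a} \<rightarrow>\<^sub>E X" "(\<lambda>c\<in>{a}. b) \<in> {a} \<rightarrow>\<^sub>E X" using ab by simp_all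
        then show "({a}, X, \<lambda>c\<in>{a}. a) \<in> Hom Ens {a} X" "({a}, X, \<lambda>c\<in>{a}. b) \<in> Hom Ens {a} X"
          unfolding Hom_Ens by blast+
        show "(X, Y, f) \<cdot>\<^bsub>Ens\<^esub> ({a}, X, \<lambda>c\<in>{a}. a) = (X, Y, f) \<cdot>\<^bsub>Ens\<^esub> ({a}, X, \<lambda>c\<in>{a}. b)"
          using ab by (auto simp: Comp_Ens compose_def fun_eq_iff)
      qed
      then show ?thesis by (auto simp: Comp_Ens compose_def fun_eq_iff split: if_splits)
    qed
    define h where "h = (\<lambda>y\<in>Y. g (inv_into X f y))"
    have inv: "inv_into X f y \<in> X" "f (inv_into X f y) = y" if "y \<in> Y" for y
      using that A by (auto intro: inv_into_into f_inv_into_f)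
    have h: "h \<in> Y \<rightarrow>\<^sub>E Z" using g inv by (auto simp: h_def)
    have hf: "h (f a) = g a" if "a \<in> X" for a
    proof -
      have "f a \<in> Y" using A that by auto
      then show ?thesis using eq[OF inv(1) that inv(2)] by (simp add: h_def)
    qed
    have fac: "compose X h f = g"
      using g hf by (auto simp: fun_eq_iff compose_def PiE_def extensional_def)
    have unique: "k = h" if k: "k \<in> Y \<rightarrow>\<^sub>E Z" "g = compose X k f" for k
    proof (rule PiE_ext[OF k(1) h])
      fix y assume "y \<in> Y"
      then obtain a where "a \<in> X" "y = f a" using A by auto
      then show "k y = h y" using k(2) hf by (simp add: compose_def)
    qed
    show ?thesis
    proof (rule ex1I)
      show "(Y, Z, h) \<in> Hom Ens Y Z \<and> (X, Z, g) = (Y, Z, h) \<cdot>\<^bsub>Ens\<^esub> (X, Y, f)"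
        using h by (simp add: Hom_Ens Comp_Ens fac)
    next
      fix \<eta> assume e: "\<eta> \<in> Hom Ens Y Z \<and> (X, Z, g) = \<eta> \<cdot>\<^bsub>Ens\<^esub> (X, Y, f)"
      then obtain k where k: "\<eta> = (Y, Z, k)" "k \<in> Y \<rightarrow>\<^sub>E Z" unfolding Hom_Ens by blast
      have "g = compose X k f" using e by (simp add: k(1) Comp_Ens)
      then show "\<eta> = (Y, Z, h)" using unique[OF k(2)] k(1) by blast
    qed
  qed
  have main: "\<exists>!\<eta>. \<eta> \<in> Hom Ens Y Z \<and> \<gamma> = \<eta> \<cdot>\<^bsub>Ens\<^esub> (X, Y, f)"
    if gm: "\<gamma> \<in> Hom Ens X Z" and K: "\<And>W \<sigma> \<tau>. \<lbrakk>\<sigma> \<in> Hom Ens W X; \<tau> \<in> Hom Ens W X;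
      (X, Y, f) \<cdot>\<^bsub>Ens\<^esub> \<sigma> = (X, Y, f) \<cdot>\<^bsub>Ens\<^esub> \<tau>\<rbrakk> \<Longrightarrow> \<gamma> \<cdot>\<^bsub>Ens\<^esub> \<sigma> = \<gamma> \<cdot>\<^bsub>Ens\<^esub> \<tau>" for Z \<gamma>
  proof -
    obtain g where g: "\<gamma> = (X, Z, g)" "g \<in> X \<rightarrow>\<^sub>E Z" using gm unfolding Hom_Ens by blast
    show ?thesis unfolding g(1) by (rule factor[OF g(2)]) (rule K[unfolded g(1)])
  qed
  have d: "Dom Ens (X, Y, f) = X" "Cod Ens (X, Y, f) = Y" "(X, Y, f) \<in> Arr Ens"
    "Obj (Ens :: ('m set, 'm set \<times> 'm set \<times> ('m \<Rightarrow> 'm)) cat) = UNIV"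
    using A by (simp_all add: Ens_def)
  show "strict_epi Ens (X, Y, f)"
    unfolding strict_epi_def d(1,2)
  proof (intro conjI d(3) ballI impI)
    fix Z \<gamma> assume \<gamma>: "\<gamma> \<in> Hom Ens X Z" and K: "\<forall>W\<in>Obj Ens. \<forall>\<sigma>\<in>Hom Ens W X. \<forall>\<tau>\<in>Hom Ens W X.
      (X, Y, f) \<cdot>\<^bsub>Ens\<^esub> \<sigma> = (X, Y, f) \<cdot>\<^bsub>Ens\<^esub> \<tau> \<longrightarrow> \<gamma> \<cdot>\<^bsub>Ens\<^esub> \<sigma> = \<gamma> \<cdot>\<^bsub>Ens\<^esub> \<tau>"
    show "\<exists>!\<eta>. \<eta> \<in> Hom Ens Y Z \<and> \<gamma> = \<eta> \<cdot>\<^bsub>Ens\<^esub> (X, Y, f)"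
      by (rule main[OF \<gamma>]) (use K[unfolded d(4)] in blast)
  qed
qed

lemma (in category) hom_functor:
  assumes "A \<in> Obj C"
  shows "cat_functor C Ens (Hom C A) (hom_map C A)"
proof -
  interpret E: category "Ens :: ('a set, 'a set \<times> 'a set \<times> ('a \<Rightarrow> 'a)) cat"
    by (rule category_Ens)
  show ?thesis
  proof
    fix X show "Hom C A X \<in> Obj Ens" by (simp add: Ens_def)
  next
    fix f X Y assume f: "f \<in> Hom C X Y"
    then have "Dom C f = X" "Cod C f = Y" by (auto simp: Hom_def)
    then show "hom_map C A f \<in> Hom Ens (Hom C A X) (Hom C A Y)"
      using Comp_closed[OF _ f] by (auto simp: Hom_Ens hom_map_def)
  next
    fix X assume "X \<in> Obj C"
    then have "Id C X \<in> Hom C X X" by (rule Id_closed)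
    then have "Dom C (Id C X) = X" "Cod C (Id C X) = X" by (auto simp: Hom_def)
    then show "hom_map C A (Id C X) = Id Ens (Hom C A X)"
      using Comp_Id_left by (auto simp: Ens_def hom_map_def fun_eq_iff restrict_def)
  next
    fix f g X Y Z assume f: "f \<in> Hom C X Y" and g: "g \<in> Hom C Y Z"
    have "g \<cdot> f \<in> Hom C X Z" using f g by (rule Comp_closed)
    then have d: "Dom C (g \<cdot> f) = X" "Cod C (g \<cdot> f) = Z" "Dom C f = X" "Cod C f = Y"
      "Dom C g = Y" "Cod C g = Z" using f g by (auto simp: Hom_def)
    show "hom_map C A (g \<cdot> f) = hom_map C A g \<cdot>\<^bsub>Ens\<^esub> hom_map C A f"
      using Comp_assoc[OF _ f g] Comp_closed[OF _ f]
      by (auto simp: Ens_def hom_map_def fun_eq_iff compose_def d)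
  qed
qed

lemma (in category) group_Aut:
  assumes A: "A \<in> Obj C"
  shows "group (Aut C A)"
proof (rule groupI)
  fix g h assume "g \<in> carrier (Aut C A)" "h \<in> carrier (Aut C A)"
  then obtain g' h' where gh: "g \<in> Hom C A A" "h \<in> Hom C A A" "g' \<in> Hom C A A" "h' \<in> Hom C A A"
    and i: "g \<cdot> g' = Id C A" "g' \<cdot> g = Id C A" "h \<cdot> h' = Id C A" "h' \<cdot> h = Id C A"
    by (auto simp: Aut_def)
  have inverse: "(u \<cdot> v) \<cdot> (v' \<cdot> u') = Id C A"
    if u: "u \<in> Hom C A A" "u' \<in> Hom C A A" "u \<cdot> u' = Id C A"
      and v: "v \<in> Hom C A A" "v' \<in> Hom C A A" "v \<cdot> v' = Id C A" for u u' v v'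
  proof -
    have "(u \<cdot> v) \<cdot> (v' \<cdot> u') = u \<cdot> ((v \<cdot> v') \<cdot> u')"
      using Comp_assoc[OF Comp_closed[OF u(2) v(2)] v(1) u(1)] Comp_assoc[OF u(2) v(2) v(1)] by simp
    then show ?thesis using u v Comp_Id_left[OF u(2)] by simp
  qed
  show "g \<otimes>\<^bsub>Aut C A\<^esub> h \<in> carrier (Aut C A)"
    using Comp_closed[OF gh(2,1)] Comp_closed[OF gh(3,4)]
      inverse[OF gh(1,3) i(1) gh(2,4) i(3)] inverse[OF gh(4,2) i(4) gh(3,1) i(2)]
    by (auto simp: Aut_def)
next
  show "\<one>\<^bsub>Aut C A\<^esub> \<in> carrier (Aut C A)"
    using Id_closed[OF A] Comp_Id_left[OF Id_closed[OF A]] by (auto simp: Aut_def)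
next
  fix f g h assume "f \<in> carrier (Aut C A)" "g \<in> carrier (Aut C A)" "h \<in> carrier (Aut C A)"
  then show "f \<otimes>\<^bsub>Aut C A\<^esub> g \<otimes>\<^bsub>Aut C A\<^esub> h = f \<otimes>\<^bsub>Aut C A\<^esub> (g \<otimes>\<^bsub>Aut C A\<^esub> h)"
    using Comp_assoc[of h A A g A f A] by (simp add: Aut_def)
next
  fix g assume "g \<in> carrier (Aut C A)"
  then show "\<one>\<^bsub>Aut C A\<^esub> \<otimes>\<^bsub>Aut C A\<^esub> g = g"
    using Comp_Id_left by (auto simp: Aut_def)
next
  fix g assume "g \<in> carrier (Aut C A)"
  then show "\<exists>h\<in>carrier (Aut C A). h \<otimes>\<^bsub>Aut C A\<^esub> g = \<one>\<^bsub>Aut C A\<^esub>"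
    by (auto simp: Aut_def)
qed

end

theory Submission imports Defs begin

text \<open>Call an arrow \<open>A \<rightarrow> X\<close> a point of \<open>X\<close>. Strict epimorphisms are epimorphisms, so every arrow
  can be cancelled on the right; and since \<open>[A,-]\<close> turns every arrow \<open>Y \<rightarrow> X\<close> into a surjection,
  every point of \<open>X\<close> lifts along it. Lifting the point \<open>Id\<close> of \<open>A\<close> along an endomorphism of \<open>A\<close> gives
  a right inverse, so every endomorphism of \<open>A\<close> is an automorphism
  (\<open>endomorphism_in_Aut_if_all_split\<close>).

  Now let \<open>x : A \<rightarrow> X\<close>, and let \<open>y : A \<rightarrow> Y\<close> be invariant under \<open>Fix x\<close>. Because \<open>x\<close> is a strict
  epimorphism, \<open>y\<close> factors uniquely through \<open>x\<close> as soon as \<open>x s = x t\<close> implies \<open>y s = y t\<close> for all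
  \<open>s, t : W \<rightarrow> A\<close>. Choose a point \<open>a : A \<rightarrow> W\<close>. Then \<open>s a\<close> and \<open>t a\<close> are endomorphisms, hence
  automorphisms, of \<open>A\<close>, and they differ by the automorphism \<open>t a (s a)\<inverse>\<close>, which lies in \<open>Fix x\<close>
  (\<open>invariant_equalizes\<close>). Hence \<open>y s a = y t a\<close>, and \<open>a\<close> is cancelled.\<close>

context category
begin

lemma carrier_Aut_iff:
  "h \<in> carrier (Aut C A) \<longleftrightarrow>
    h \<in> Hom C A A \<and> (\<exists>k\<in>Hom C A A. h \<cdot> k = Id C A \<and> k \<cdot> h = Id C A)"
  by (simp add: Aut_def)

lemma mult_Aut: "g \<otimes>\<^bsub>Aut C A\<^esub> h = g \<cdot> h"
  by (simp add: Aut_def)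

lemma one_Aut: "\<one>\<^bsub>Aut C A\<^esub> = Id C A"
  by (simp add: Aut_def)

lemma Fix_iff:
  assumes "x \<in> Hom C A X"
  shows "h \<in> Fix C x \<longleftrightarrow> h \<in> carrier (Aut C A) \<and> x \<cdot> h = x"
  using assms by (simp add: Fix_def Hom_def)

lemma subgroup_Fix:
  assumes A: "A \<in> Obj C" and x: "x \<in> Hom C A X"
  shows "subgroup (Fix C x) (Aut C A)"
proof -
  interpret G: group "Aut C A" by (rule group_Aut[OF A])
  show ?thesis
  proof (rule G.subgroupI)
    show "Fix C x \<subseteq> carrier (Aut C A)" by (auto simp: Fix_iff[OF x])
    have "Id C A \<in> Fix C x"
      using G.one_closed Comp_Id_right[OF x] by (simp add: Fix_iff[OF x] one_Aut)
    then show "Fix C x \<noteq> {}" by blast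
  next
    fix g assume "g \<in> Fix C x"
    then have g: "g \<in> carrier (Aut C A)" "x \<cdot> g = x" by (simp_all add: Fix_iff[OF x])
    let ?i = "inv\<^bsub>Aut C A\<^esub> g"
    have i: "?i \<in> carrier (Aut C A)" "g \<cdot> ?i = Id C A"
      using G.inv_closed[OF g(1)] G.r_inv[OF g(1)] by (simp_all add: mult_Aut one_Aut)
    have "x \<cdot> ?i = (x \<cdot> g) \<cdot> ?i" by (simp add: g(2))
    also have "\<dots> = x \<cdot> (g \<cdot> ?i)"
      by (rule Comp_assoc[OF _ _ x]) (use g(1) i(1) in \<open>auto simp: carrier_Aut_iff\<close>)
    also have "\<dots> = x" by (simp add: i(2) Comp_Id_right[OF x])
    finally show "?i \<in> Fix C x" using i(1) by (simp add: Fix_iff[OF x])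
  next
    fix g h assume "g \<in> Fix C x" "h \<in> Fix C x"
    then have gh: "g \<in> carrier (Aut C A)" "x \<cdot> g = x" "h \<in> carrier (Aut C A)" "x \<cdot> h = x"
      by (simp_all add: Fix_iff[OF x])
    have "x \<cdot> (g \<cdot> h) = (x \<cdot> g) \<cdot> h"
      by (rule Comp_assoc[OF _ _ x, symmetric]) (use gh in \<open>auto simp: carrier_Aut_iff\<close>)
    then show "g \<otimes>\<^bsub>Aut C A\<^esub> h \<in> Fix C x"
      using G.m_closed[OF gh(1,3)] gh(2,4) by (simp add: Fix_iff[OF x] mult_Aut)
  qed
qed

lemma strict_epi_factors:
  assumes f: "strict_epi C f" "f \<in> Hom C X Y" and g: "g \<in> Hom C X Z"
    and equalizes: "\<And>W s t. \<lbrakk>W \<in> Obj C; s \<in> Hom C W X; t \<in> Hom C W X; f \<cdot> s = f \<cdot> t\<rbrakk>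
      \<Longrightarrow> g \<cdot> s = g \<cdot> t"
  shows "\<exists>!h. h \<in> Hom C Y Z \<and> h \<cdot> f = g"
proof -
  have "Dom C f = X" "Cod C f = Y" "Z \<in> Obj C"
    using f(2) g Cod_closed by (auto simp: Hom_def)
  then have "\<exists>!h. h \<in> Hom C Y Z \<and> g = h \<cdot> f"
    using f(1) g equalizes unfolding strict_epi_def by blast
  then show ?thesis by (simp only: eq_commute[of g])
qed

text \<open>An arrow of the form \<open>u f\<close> identifies whatever \<open>f\<close> identifies, so the uniqueness half of
  strictness applies to it.\<close>

lemma strict_epi_cancel:
  assumes f: "strict_epi C f" "f \<in> Hom C X Y"
    and u: "u \<in> Hom C Y Z" and v: "v \<in> Hom C Y Z" and eq: "u \<cdot> f = v \<cdot> f"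
  shows "u = v"
proof -
  have "\<exists>!h. h \<in> Hom C Y Z \<and> h \<cdot> f = u \<cdot> f"
  proof (rule strict_epi_factors[OF f Comp_closed[OF f(2) u]])
    fix W s t assume "s \<in> Hom C W X" "t \<in> Hom C W X" "f \<cdot> s = f \<cdot> t"
    then show "(u \<cdot> f) \<cdot> s = (u \<cdot> f) \<cdot> t"
      using Comp_assoc[OF _ f(2) u] by simp
  qed
  then show ?thesis using u v eq by (elim ex1E) metis
qed

lemma lift_along_strict_epi:
  assumes pres: "preserves_strict_epis C Ens (hom_map C A)"
    and f: "strict_epi C f" "f \<in> Hom C Y X" and u: "u \<in> Hom C A X"
  obtains v where "v \<in> Hom C A Y" "f \<cdot> v = u"
proof -
  have "strict_epi Ens (hom_map C A f)"
    using pres f(1) by (simp add: preserves_strict_epis_def)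
  then have "(\<lambda>v. f \<cdot> v) ` Hom C A Y = Hom C A X"
    using f(2) by (simp add: hom_map_def strict_epi_Ens_iff Hom_def)
  with u have "u \<in> (\<lambda>v. f \<cdot> v) ` Hom C A Y" by simp
  then show ?thesis using that by blast
qed

text \<open>A right inverse \<open>k\<close> of \<open>e\<close> has itself a right inverse, which can only be \<open>e\<close>; so \<open>k\<close> is a
  two-sided inverse.\<close>

lemma endomorphism_in_Aut_if_all_split:
  assumes split: "\<And>e. e \<in> Hom C A A \<Longrightarrow> \<exists>k\<in>Hom C A A. e \<cdot> k = Id C A"
    and e: "e \<in> Hom C A A"
  shows "e \<in> carrier (Aut C A)"
proof -
  obtain k where k: "k \<in> Hom C A A" "e \<cdot> k = Id C A" using split[OF e] by blast
  obtain l where l: "l \<in> Hom C A A" "k \<cdot> l = Id C A" using split[OF k(1)] by blast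
  have "l = (e \<cdot> k) \<cdot> l" by (simp add: k(2) Comp_Id_left[OF l(1)])
  also have "\<dots> = e \<cdot> (k \<cdot> l)" by (rule Comp_assoc[OF l(1) k(1) e])
  also have "\<dots> = e" by (simp add: l(2) Comp_Id_right[OF e])
  finally show ?thesis using e k l(2) by (auto simp: carrier_Aut_iff)
qed

text \<open>The equation \<open>x p = x q\<close> puts \<open>q p\<inverse>\<close> into \<open>Fix x\<close>, so \<open>y\<close> absorbs this automorphism:
  \<open>y p = y (q p\<inverse>) p\<close>.\<close>

lemma invariant_equalizes:
  assumes A: "A \<in> Obj C" and x: "x \<in> Hom C A X" and y: "y \<in> Hom C A Y"
    and invariant: "\<And>h. h \<in> Fix C x \<Longrightarrow> y \<cdot> h = y"
    and p: "p \<in> carrier (Aut C A)" and q: "q \<in> carrier (Aut C A)" and eq: "x \<cdot> p = x \<cdot> q"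
  shows "y \<cdot> p = y \<cdot> q"
proof -
  interpret G: group "Aut C A" by (rule group_Aut[OF A])
  define r where "r = inv\<^bsub>Aut C A\<^esub> p"
  have r: "r \<in> carrier (Aut C A)" "p \<cdot> r = Id C A" "r \<cdot> p = Id C A"
    using G.inv_closed[OF p] G.r_inv[OF p] G.l_inv[OF p] by (simp_all add: r_def mult_Aut one_Aut)
  have H: "p \<in> Hom C A A" "q \<in> Hom C A A" "r \<in> Hom C A A"
    using p q r(1) by (simp_all add: carrier_Aut_iff)
  have "x \<cdot> (q \<cdot> r) = x \<cdot> (p \<cdot> r)"
    using Comp_assoc[OF H(3,2) x] Comp_assoc[OF H(3,1) x] eq by simp
  also have "\<dots> = x" by (simp add: r(2) Comp_Id_right[OF x])
  finally have "q \<cdot> r \<in> Fix C x"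
    using G.m_closed[OF q r(1)] by (simp add: Fix_iff[OF x] mult_Aut)
  then have "y \<cdot> p = (y \<cdot> (q \<cdot> r)) \<cdot> p" by (simp add: invariant)
  also have "\<dots> = y \<cdot> (q \<cdot> (r \<cdot> p))"
    using Comp_assoc[OF H(1) Comp_closed[OF H(3,2)] y] Comp_assoc[OF H(1,3,2)] by simp
  also have "\<dots> = y \<cdot> q" by (simp add: r(3) Comp_Id_right[OF H(2)])
  finally show ?thesis .
qed

end

theorem theorem1p3:
  fixes C :: "('o, 'a) cat" and A :: 'o
  assumes "category C" and "A \<in> Obj C"
    and strict: "\<And>X Y f. \<lbrakk>X \<in> Obj C; Y \<in> Obj C; f \<in> Hom C Y X\<rbrakk> \<Longrightarrow> strict_epi C f"
    and covers: "\<And>X. X \<in> Obj C \<Longrightarrow> \<exists>x. x \<in> Hom C A X"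
    and preserves: "preserves_strict_epis C Ens (hom_map C A)"
  shows "\<forall>X\<in>Obj C. \<forall>x\<in>Hom C A X. categorical_quotient C A (Fix C x) X x"
proof (intro ballI)
  fix X x assume X: "X \<in> Obj C" and x: "x \<in> Hom C A X"
  interpret category C by fact
  note A = \<open>A \<in> Obj C\<close>
  have Aut: "e \<in> carrier (Aut C A)" if "e \<in> Hom C A A" for e
  proof (rule endomorphism_in_Aut_if_all_split[OF _ that])
    fix e assume e: "e \<in> Hom C A A"
    show "\<exists>k\<in>Hom C A A. e \<cdot>\<^bsub>C\<^esub> k = Id C A"
      by (rule lift_along_strict_epi[OF preserves strict[OF A A e] e Id_closed[OF A]]) blast
  qed
  have "\<exists>!g. g \<in> Hom C X Y \<and> g \<cdot>\<^bsub>C\<^esub> x = y"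
    if Y: "Y \<in> Obj C" and y: "y \<in> Hom C A Y"
      and invariant: "\<And>h. h \<in> Fix C x \<Longrightarrow> y \<cdot>\<^bsub>C\<^esub> h = y" for Y y
  proof (rule strict_epi_factors[OF strict[OF X A x] x y])
    fix W s t
    assume W: "W \<in> Obj C" and s: "s \<in> Hom C W A" and t: "t \<in> Hom C W A"
      and eq: "x \<cdot>\<^bsub>C\<^esub> s = x \<cdot>\<^bsub>C\<^esub> t"
    obtain a where a: "a \<in> Hom C A W" using covers[OF W] by blast
    have "y \<cdot>\<^bsub>C\<^esub> (s \<cdot>\<^bsub>C\<^esub> a) = y \<cdot>\<^bsub>C\<^esub> (t \<cdot>\<^bsub>C\<^esub> a)"
    proof (rule invariant_equalizes[OF A x y invariant])
      show "s \<cdot>\<^bsub>C\<^esub> a \<in> carrier (Aut C A)" "t \<cdot>\<^bsub>C\<^esub> a \<in> carrier (Aut C A)"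
        by (rule Aut[OF Comp_closed[OF a s]], rule Aut[OF Comp_closed[OF a t]])
      show "x \<cdot>\<^bsub>C\<^esub> (s \<cdot>\<^bsub>C\<^esub> a) = x \<cdot>\<^bsub>C\<^esub> (t \<cdot>\<^bsub>C\<^esub> a)"
        using Comp_assoc[OF a s x] Comp_assoc[OF a t x] eq by simp
    qed
    then have "(y \<cdot>\<^bsub>C\<^esub> s) \<cdot>\<^bsub>C\<^esub> a = (y \<cdot>\<^bsub>C\<^esub> t) \<cdot>\<^bsub>C\<^esub> a"
      using Comp_assoc[OF a s y] Comp_assoc[OF a t y] by simp
    then show "y \<cdot>\<^bsub>C\<^esub> s = y \<cdot>\<^bsub>C\<^esub> t"
      by (rule strict_epi_cancel[OF strict[OF W A a] a Comp_closed[OF s y] Comp_closed[OF t y]])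
  qed
  moreover have "\<forall>h\<in>Fix C x. x \<cdot>\<^bsub>C\<^esub> h = x" by (simp add: Fix_iff[OF x])
  ultimately show "categorical_quotient C A (Fix C x) X x"
    using subgroup_Fix[OF A x] x unfolding categorical_quotient_def by blast
qed

end
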